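(* Assume that all suffix domains $\mathcal X_0,\ldots,\mathcal X_N$ are nonempty, and let $i\in\{0,\ldots,N-1\}$. For every $z_i\in\mathbb R^{\bar n_i}$, the linear system in $u_i\in\mathbb R^{m_i}$ $$\Gamma_iu_i+\Phi_iz_i+\gamma_i=0$$ is consistent. Moreover, there exist matrices $Y_i$, $Z_i$ and a vector $y_i$ (independent of $z_i$), with the columns of $Z_i\in\mathbb R^{m_i\times\bar m_i}$ forming a basis of the null space of $\Gamma_i$, such that for every $z_i$ all the solutions of this system are $$u_i=Y_iz_i+Z_iv_i+y_i,\qquad v_i\in\mathbb R^{\bar m_i}.$$
   Context: Setting: a horizon $N\ge 1$; state dimensions $n_0,\ldots,n_N$ and control dimensions $m_0,\ldots,m_{N-1}$ that may vary by stage; real matrices and vectors of compatible sizes $A_i\in\mathbb R^{n_{i+1}\times n_i}$, $B_i\in\mathbb R^{n_{i+1}\times m_i}$, $c_i\in\mathbb R^{n_{i+1}}$, $C_i,D_i,d_i$ (for $i=0,\ldots,N-1$), and $E_i,e_i$ (for $i=0,\ldots,N$). Empty matrices represent absent constraints; no rank assumptions are made. The stage constraints are $$x_{i+1}=A_ix_i+B_iu_i+c_i,\quad C_ix_i+D_iu_i+d_i=0,\quad E_ix_i+e_i=0\qquad(i=0,\ldots,N-1),$$ and the terminal constraint is $E_Nx_N+e_N=0$. The suffix domain $\mathcal X_i\subseteq\mathbb R^{n_i}$ is the set of $x_i$ from which there exist controls $u_i,\ldots,u_{N-1}$ and states $x_{i+1},\ldots,x_N$ satisfying all stage constraints for stages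 $i,\ldots,N-1$ and the terminal constraint. It is an affine set, represented as $\mathcal X_i=\{x_i:H_ix_i+h_i=0\}$ for some chosen $H_i,h_i$. When all $\mathcal X_i$ are nonempty, choose $t_i$ with $H_it_i+h_i=0$ and $T_i\in\mathbb R^{n_i\times\bar n_i}$ whose columns form a basis of the null space of $H_i$, so $\mathcal X_i=\{T_iz_i+t_i:z_i\in\mathbb R^{\bar n_i}\}$. For $i=0,\ldots,N-1$ define $$\Gamma_i=\begin{bmatrix}D_i\\H_{i+1}B_i\end{bmatrix},\qquad \Phi_i=\begin{bmatrix}C_iT_i\\H_{i+1}A_iT_i\end{bmatrix},\qquad \gamma_i=\begin{bmatrix}C_it_i+d_i\\H_{i+1}(A_it_i+c_i)+h_{i+1}\end{bmatrix}.$$ *)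

theory Defs
  imports Complex_Main "Jordan_Normal_Form.Matrix_Kernel"
begin

text \<open>
  Dimensions vary with the stage, so matrices and vectors are those with explicit carriers.
  Families are indexed by \<^typ>\<open>nat\<close>; only the indices permitted by
  \<open>well_formed\<close> matter. A constraint is absent if its matrix has zero rows.
\<close>

record stage_constraints =
  horizon :: nat
  xdim :: "nat \<Rightarrow> nat"
  udim :: "nat \<Rightarrow> nat"
  matA :: "nat \<Rightarrow> real mat"
  matB :: "nat \<Rightarrow> real mat"
  vecc :: "nat \<Rightarrow> real vec"
  matC :: "nat \<Rightarrow> real mat"
  matD :: "nat \<Rightarrow> real mat"
  vecd :: "nat \<Rightarrow> real vec"
  matE :: "nat \<Rightarrow> real mat"
  vece :: "nat \<Rightarrow> real vec"

definition well_formed :: "stage_constraints \<Rightarrow> bool" where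
  "well_formed P \<longleftrightarrow>
     1 \<le> horizon P \<and>
     (\<forall>i < horizon P.
        matA P i \<in> carrier_mat (xdim P (Suc i)) (xdim P i) \<and>
        matB P i \<in> carrier_mat (xdim P (Suc i)) (udim P i) \<and>
        vecc P i \<in> carrier_vec (xdim P (Suc i)) \<and>
        matC P i \<in> carrier_mat (dim_vec (vecd P i)) (xdim P i) \<and>
        matD P i \<in> carrier_mat (dim_vec (vecd P i)) (udim P i)) \<and>
     (\<forall>i \<le> horizon P. matE P i \<in> carrier_mat (dim_vec (vece P i)) (xdim P i))"

definition state_ok :: "stage_constraints \<Rightarrow> nat \<Rightarrow> real vec \<Rightarrow> bool" where
  "state_ok P i x \<longleftrightarrow> matE P i *\<^sub>v x + vece P i = 0\<^sub>v (dim_vec (vece P i))"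

definition stage_ok ::
  "stage_constraints \<Rightarrow> nat \<Rightarrow> real vec \<Rightarrow> real vec \<Rightarrow> real vec \<Rightarrow> bool" where
  "stage_ok P i x u x' \<longleftrightarrow>
     x' = matA P i *\<^sub>v x + matB P i *\<^sub>v u + vecc P i \<and>
     matC P i *\<^sub>v x + matD P i *\<^sub>v u + vecd P i = 0\<^sub>v (dim_vec (vecd P i)) \<and>
     state_ok P i x"

definition suffix_domain :: "stage_constraints \<Rightarrow> nat \<Rightarrow> real vec set" where
  "suffix_domain P i =
     {x \<in> carrier_vec (xdim P i).
        \<exists>xs us. xs i = x \<and>
          (\<forall>k \<in> {i..horizon P}. xs k \<in> carrier_vec (xdim P k)) \<and>
          (\<forall>k \<in> {i..<horizon P}. us k \<in> carrier_vec (udim P k) \<and>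
             stage_ok P k (xs k) (us k) (xs (Suc k))) \<and>
          state_ok P (horizon P) (xs (horizon P))}"

text \<open>
  The library's notion of basis concerns sets of vectors, hence the separate requirement that the
  columns be distinct; the carrier condition fixes the number of rows when there are no columns.
\<close>

definition null_space_basis :: "real mat \<Rightarrow> nat \<Rightarrow> real mat \<Rightarrow> bool" where
  "null_space_basis M k Z \<longleftrightarrow>
     Z \<in> carrier_mat (dim_col M) k \<and> distinct (cols Z) \<and>
     kernel.basis (dim_col M) M (set (cols Z))"

definition Gamma :: "stage_constraints \<Rightarrow> (nat \<Rightarrow> real mat) \<Rightarrow> nat \<Rightarrow> real mat" where
  "Gamma P H i = matD P i @\<^sub>r (H (Suc i) * matB P i)"

definition Phi ::
  "stage_constraints \<Rightarrow> (nat \<Rightarrow> real mat) \<Rightarrow> (nat \<Rightarrow> real mat) \<Rightarrow> nat \<Rightarrow> real mat" where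
  "Phi P H T i = (matC P i * T i) @\<^sub>r (H (Suc i) * matA P i * T i)"

definition gamma ::
  "stage_constraints \<Rightarrow> (nat \<Rightarrow> real mat) \<Rightarrow> (nat \<Rightarrow> real vec) \<Rightarrow> (nat \<Rightarrow> real vec) \<Rightarrow> nat \<Rightarrow> real vec"
  where
  "gamma P H h t i =
     (matC P i *\<^sub>v t i + vecd P i) @\<^sub>v
     (H (Suc i) *\<^sub>v (matA P i *\<^sub>v t i + vecc P i) + h (Suc i))"

end

theory Submission
  imports Defs
begin

text \<open>Substitute \<open>x = T i z + t i\<close>, which parametrizes the suffix domain at stage
  \<open>i\<close>. The upper block of the system is then the mixed constraint
  \<open>C x + D u + d = 0\<close>, and the lower block says that the successor
  \<open>A x + B u + c\<close> satisfies the equation of the next suffix domain. A feasible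
  trajectory from \<open>x\<close> supplies such a \<open>u\<close>, because its tail is again
  feasible (\<open>suffix_domain_successor\<close>); hence the system is consistent for every
  \<open>z\<close>. The rest is linear algebra (\<open>parametric_system_solutions\<close>): a
  system affine in \<open>z\<close> and solvable for all \<open>z\<close> has a solution
  \<open>Y z + y\<close> affine in \<open>z\<close>, and all other solutions differ from it by
  elements of the kernel of \<open>Gamma\<close>, which is the range of \<open>Z\<close>
  (\<open>mat_kernel_eq_range\<close>). \<open>Y\<close>, \<open>y\<close> and \<open>Z\<close> are
  fixed before \<open>z\<close>, hence independent of it.\<close>

lemma null_space_basis_exists:
  obtains k Z where "null_space_basis M k Z"
proof -
  have M: "M \<in> carrier_mat (dim_row M) (dim_col M)" by simp
  interpret kernel "dim_row M" "dim_col M" M by unfold_locales (rule M)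
  obtain B where B: "finite B" "basis B"
    using kernel_basis_exists[OF M] by blast
  obtain bs where bs: "set bs = B" "distinct bs"
    using finite_distinct_list[OF B(1)] by blast
  have "set bs \<subseteq> carrier_vec (dim_col M)"
    using B(2) bs(1) mat_kernel_carrier[OF M] unfolding Ker.basis_def by auto
  then have "null_space_basis M (length bs) (mat_of_cols (dim_col M) bs)"
    using B(2) bs unfolding null_space_basis_def by simp
  then show thesis by (rule that)
qed

text \<open>Used twice: for \<open>T i\<close>, to see that \<open>T i z + t i\<close> stays in the
  suffix domain, and for \<open>Z\<close>, to describe all solutions.\<close>

lemma mat_kernel_eq_range:
  assumes M: "M \<in> carrier_mat nr n" and Z: "null_space_basis M k Z"
  shows "mat_kernel M = {Z *\<^sub>v v | v. v \<in> carrier_vec k}"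
proof -
  interpret kernel nr n M by unfold_locales (rule M)
  have Zc: "Z \<in> carrier_mat n k" and b: "basis (set (cols Z))"
    using Z M unfolding null_space_basis_def by auto
  \<comment> \<open>The span taken inside the kernel agrees with the span in the ambient space,
    which is the column space.\<close>
  then have "mat_kernel M = NC.col_space Z"
    using span_same[of "set (cols Z)"] unfolding NC.col_space_def Ker.basis_def by auto
  also have "\<dots> = {Z *\<^sub>v v | v. v \<in> carrier_vec k}"
    unfolding NC.col_space_eq[OF Zc] using Zc by auto
  finally show ?thesis .
qed

lemma mult_mat_unit_vec:
  fixes A :: "'a :: semiring_1 mat"
  assumes "A \<in> carrier_mat nr nc" and "j < nc"
  shows "A *\<^sub>v unit_vec nc j = col A j"
  using assms by (intro eq_vecI) auto

text \<open>A linear selection of solutions is obtained by interpolating solutions chosen for the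
  parameters \<open>0\<close> and the unit vectors.\<close>

lemma parametric_system_solutions:
  fixes M F :: "'a :: field mat"
  assumes M: "M \<in> carrier_mat nr m" and F: "F \<in> carrier_mat nr k" and g: "g \<in> carrier_vec nr"
    and solvable: "\<And>z. z \<in> carrier_vec k \<Longrightarrow> 
      \<exists>u \<in> carrier_vec m. M *\<^sub>v u + F *\<^sub>v z + g = 0\<^sub>v nr"
  obtains Y y where "Y \<in> carrier_mat m k" "y \<in> carrier_vec m"
    "\<And>z u. z \<in> carrier_vec k \<Longrightarrow> u \<in> carrier_vec m \<Longrightarrow>
      M *\<^sub>v u + F *\<^sub>v z + g = 0\<^sub>v nr \<longleftrightarrow> u - (Y *\<^sub>v z + y) \<in> mat_kernel M"
proof -
  \<comment> \<open>\<open>U\<close> is an arbitrary choice of solutions and need not be affine in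
    \<open>z\<close>; only its values at zero and at the unit vectors are used below.\<close>
  obtain U where U: "\<And>z. z \<in> carrier_vec k \<Longrightarrow> U z \<in> carrier_vec m"
    "\<And>z. z \<in> carrier_vec k \<Longrightarrow> M *\<^sub>v U z + F *\<^sub>v z + g = 0\<^sub>v nr"
    using solvable by metis
  define y where "y = U (0\<^sub>v k)"
  define Y where "Y = mat_of_cols m (map (\<lambda>j. U (unit_vec k j) - y) [0..<k])"
  have y: "y \<in> carrier_vec m" unfolding y_def by (rule U) simp
  have Y: "Y \<in> carrier_mat m k" unfolding Y_def by auto
  have My: "M *\<^sub>v y = - g"
  proof -
    have "F *\<^sub>v 0\<^sub>v k = 0\<^sub>v nr" using F by auto
    then have "M *\<^sub>v y + g = 0\<^sub>v nr" using U(2)[of "0\<^sub>v k"] M y unfolding y_def by simp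
    then show ?thesis
      using M g by (auto simp: vec_eq_iff eq_neg_iff_add_eq_0)
  qed
  \<comment> \<open>Column \<open>j\<close>: subtracting the equations solved by
    \<open>U (unit_vec k j)\<close> and by \<open>y\<close> cancels \<open>g\<close> and leaves
    minus the column of \<open>F\<close>.\<close>
  have MY: "M * Y = - F"
  proof (rule mat_col_eqI)
    fix j assume "j < dim_col (- F)"
    then have j: "j < k" using F by simp
    have e: "U (unit_vec k j) \<in> carrier_vec m" by (rule U) simp
    have "M *\<^sub>v U (unit_vec k j) + col F j + g = 0\<^sub>v nr"
      using U(2)[of "unit_vec k j"] mult_mat_unit_vec[OF F j] by simp
    moreover have "col (M * Y) j = M *\<^sub>v (U (unit_vec k j) - y)"
      unfolding col_mult2[OF M Y j] using j e y by (simp add: Y_def)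
    ultimately show "col (M * Y) j = col (- F) j"
      unfolding mult_minus_distrib_mat_vec[OF M e y] My
      using M F g j by (auto simp: vec_eq_iff eq_neg_iff_add_eq_0 ac_simps)
  qed (use M F Y in auto)
  have "M *\<^sub>v u + F *\<^sub>v z + g = 0\<^sub>v nr \<longleftrightarrow> u - (Y *\<^sub>v z + y) \<in> mat_kernel M"
    if z: "z \<in> carrier_vec k" and u: "u \<in> carrier_vec m" for z u
  proof -
    have Yz: "Y *\<^sub>v z \<in> carrier_vec m" using Y z by simp
    have "M *\<^sub>v (Y *\<^sub>v z) = - (F *\<^sub>v z)"
      using assoc_mult_mat_vec[OF M Y z] MY F z by simp
    \<comment> \<open>\<open>M\<close> maps the deviation from the affine candidate to exactly the
      residual of the system, so one vanishes iff the other does.\<close>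
    then have "M *\<^sub>v (u - (Y *\<^sub>v z + y)) = M *\<^sub>v u - (- (F *\<^sub>v z) + - g)"
      using mult_minus_distrib_mat_vec[OF M u] mult_add_distrib_mat_vec[OF M Yz y] Yz y My by simp
    also have "\<dots> = M *\<^sub>v u + F *\<^sub>v z + g"
      using M F g u z by (intro eq_vecI) auto
    finally show ?thesis
      unfolding mat_kernel[OF M] using u Yz y by simp
  qed
  then show thesis using that[OF Y y] by blast
qed

lemma append_rows_affine:
  fixes D B C A :: "'a :: comm_ring_1 mat"
  assumes D: "D \<in> carrier_mat r m" and B: "B \<in> carrier_mat s m"
    and C: "C \<in> carrier_mat r k" and A: "A \<in> carrier_mat s k"
    and c: "c \<in> carrier_vec r" and a: "a \<in> carrier_vec s"
    and u: "u \<in> carrier_vec m" and z: "z \<in> carrier_vec k"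
  shows "(D @\<^sub>r B) *\<^sub>v u + (C @\<^sub>r A) *\<^sub>v z + (c @\<^sub>v a) =
    (D *\<^sub>v u + C *\<^sub>v z + c) @\<^sub>v (B *\<^sub>v u + A *\<^sub>v z + a)"
  unfolding mat_mult_append[OF D B u] mat_mult_append[OF C A z]
  using assms by (intro eq_vecI) (auto simp: append_vec_def)

lemma zero_append_vec: "0\<^sub>v r @\<^sub>v 0\<^sub>v s = 0\<^sub>v (r + s)"
  by (rule eq_vecI) auto

text \<open>Drop the first stage of a feasible trajectory. Trajectories are indexed by absolute
  stage, so the same \<open>xs\<close> and \<open>us\<close> serve as witnesses without a
  shift.\<close>

lemma suffix_domain_successor:
  assumes "x \<in> suffix_domain P i" and i: "i < horizon P"
  obtains u x' where "u \<in> carrier_vec (udim P i)" "stage_ok P i x u x'"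
    "x' \<in> suffix_domain P (Suc i)"
proof -
  obtain xs us where xs: "xs i = x"
      "\<And>k. k \<in> {i..horizon P} \<Longrightarrow> xs k \<in> carrier_vec (xdim P k)"
      "\<And>k. k \<in> {i..<horizon P} \<Longrightarrow>
         us k \<in> carrier_vec (udim P k) \<and> stage_ok P k (xs k) (us k) (xs (Suc k))"
      "state_ok P (horizon P) (xs (horizon P))"
    using assms(1) unfolding suffix_domain_def by blast
  have "xs (Suc i) \<in> suffix_domain P (Suc i)"
    unfolding suffix_domain_def mem_Collect_eq
    by (rule conjI[OF _ exI[of _ xs, OF exI[of _ us]]]) (use xs i in auto)
  then show thesis using that[of "us i" "xs (Suc i)"] xs(1) xs(3)[of i] i by auto
qed

theorem lemma4:
  fixes P :: stage_constraints
    and H T :: "nat \<Rightarrow> real mat"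
    and h t :: "nat \<Rightarrow> real vec"
    and nbar :: "nat \<Rightarrow> nat"
    and i :: nat
  assumes "well_formed P"
    and "\<And>j. j \<le> horizon P \<Longrightarrow> suffix_domain P j \<noteq> {}"
    and "\<And>j. j \<le> horizon P \<Longrightarrow> H j \<in> carrier_mat (dim_vec (h j)) (xdim P j)"
    and "\<And>j. j \<le> horizon P \<Longrightarrow>
           suffix_domain P j =
             {x \<in> carrier_vec (xdim P j). H j *\<^sub>v x + h j = 0\<^sub>v (dim_vec (h j))}"
    and "\<And>j. j \<le> horizon P \<Longrightarrow>
           t j \<in> carrier_vec (xdim P j) \<and> H j *\<^sub>v t j + h j = 0\<^sub>v (dim_vec (h j))"
    and "\<And>j. j \<le> horizon P \<Longrightarrow> null_space_basis (H j) (nbar j) (T j)"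
    and "i < horizon P"
  shows "(\<forall>z \<in> carrier_vec (nbar i). \<exists>u \<in> carrier_vec (udim P i).
            Gamma P H i *\<^sub>v u + Phi P H T i *\<^sub>v z + gamma P H h t i
              = 0\<^sub>v (dim_row (Gamma P H i)))
       \<and> (\<exists>Y Z y mbar.
            Y \<in> carrier_mat (udim P i) (nbar i) \<and>
            Z \<in> carrier_mat (udim P i) mbar \<and>
            y \<in> carrier_vec (udim P i) \<and>
            null_space_basis (Gamma P H i) mbar Z \<and>
            (\<forall>z \<in> carrier_vec (nbar i).
               {u \<in> carrier_vec (udim P i).
                  Gamma P H i *\<^sub>v u + Phi P H T i *\<^sub>v z + gamma P H h t i
                    = 0\<^sub>v (dim_row (Gamma P H i))}
               = {Y *\<^sub>v z + Z *\<^sub>v v + y | v. v \<in> carrier_vec mbar}))"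
proof -
  define n m k r s where "n = xdim P i" and "m = udim P i" and "k = nbar i"
    and "r = dim_vec (vecd P i)" and "s = dim_vec (h (Suc i))"
  define n' where "n' = xdim P (Suc i)"
  note dims = n_def m_def k_def r_def s_def n'_def
  define A B c C D d H' h' where "A = matA P i" and "B = matB P i" and "c = vecc P i"
    and "C = matC P i" and "D = matD P i" and "d = vecd P i"
    and "H' = H (Suc i)" and "h' = h (Suc i)"
  note data = A_def B_def c_def C_def D_def d_def H'_def h'_def
  have i: "i \<le> horizon P" "Suc i \<le> horizon P" using assms(7) by auto
  have A: "A \<in> carrier_mat n' n" and B: "B \<in> carrier_mat n' m" and c: "c \<in> carrier_vec n'"
    and C: "C \<in> carrier_mat r n" and D: "D \<in> carrier_mat r m" and d: "d \<in> carrier_vec r"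
    using assms(1,7) unfolding well_formed_def dims data by auto
  have H': "H' \<in> carrier_mat s n'" and h': "h' \<in> carrier_vec s"
    using assms(3)[OF i(2)] unfolding dims data by auto
  have Hi: "H i \<in> carrier_mat (dim_vec (h i)) n"
    using assms(3)[OF i(1)] unfolding dims .
  have t: "t i \<in> carrier_vec n" "H i *\<^sub>v t i + h i = 0\<^sub>v (dim_vec (h i))"
    using assms(5)[OF i(1)] unfolding dims by auto
  have Ti: "T i \<in> carrier_mat n k"
    using assms(6)[OF i(1)] Hi unfolding null_space_basis_def dims by auto
  have G: "Gamma P H i \<in> carrier_mat (r + s) m"
    unfolding Gamma_def data[symmetric] using D H' B by auto
  have F: "Phi P H T i \<in> carrier_mat (r + s) k"
    unfolding Phi_def data[symmetric] using C H' A Ti by auto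
  have g: "gamma P H h t i \<in> carrier_vec (r + s)"
    unfolding gamma_def data[symmetric] using C H' A t(1) c d h' by auto
  \<comment> \<open>The key identity: in terms of \<open>x\<close>, the stacked residual consists of
    the mixed constraint and of the defining equation of the next suffix domain at the successor
    state.\<close>
  have system: "Gamma P H i *\<^sub>v u + Phi P H T i *\<^sub>v z + gamma P H h t i =
      (C *\<^sub>v x + D *\<^sub>v u + d) @\<^sub>v (H' *\<^sub>v (A *\<^sub>v x + B *\<^sub>v u + c) + h')"
    if z: "z \<in> carrier_vec k" and u: "u \<in> carrier_vec m" and x: "x = T i *\<^sub>v z + t i" for z u x
  proof -
    have Tz: "T i *\<^sub>v z \<in> carrier_vec n" using Ti z by simp
    have "D *\<^sub>v u + (C * T i) *\<^sub>v z + (C *\<^sub>v t i + d) = C *\<^sub>v x + D *\<^sub>v u + d"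
      unfolding x assoc_mult_mat_vec[OF C Ti z] mult_add_distrib_mat_vec[OF C Tz t(1)]
      using C D d by (intro eq_vecI) auto
    moreover have "(H' * B) *\<^sub>v u + (H' * A * T i) *\<^sub>v z + (H' *\<^sub>v (A *\<^sub>v t i + c) + h') =
        H' *\<^sub>v (A *\<^sub>v x + B *\<^sub>v u + c) + h'"
    proof -
      have HA: "H' * A \<in> carrier_mat s n" using H' A by simp
      have *: "A *\<^sub>v (T i *\<^sub>v z) \<in> carrier_vec n'" "A *\<^sub>v t i \<in> carrier_vec n'"
        "B *\<^sub>v u \<in> carrier_vec n'" "A *\<^sub>v (T i *\<^sub>v z) + A *\<^sub>v t i \<in> carrier_vec n'"
        "A *\<^sub>v (T i *\<^sub>v z) + A *\<^sub>v t i + B *\<^sub>v u \<in> carrier_vec n'"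
        using A B t(1) Tz u by auto
      \<comment> \<open>Distribute \<open>H'\<close> and \<open>A\<close> over all sums; both sides
        then consist of the same summands up to order.\<close>
      show ?thesis
        unfolding x assoc_mult_mat_vec[OF H' B u] assoc_mult_mat_vec[OF HA Ti z]
          assoc_mult_mat_vec[OF H' A Tz] mult_add_distrib_mat_vec[OF A Tz t(1)]
          mult_add_distrib_mat_vec[OF H' *(5) c] mult_add_distrib_mat_vec[OF H' *(4,3)]
          mult_add_distrib_mat_vec[OF H' *(1,2)] mult_add_distrib_mat_vec[OF H' *(2) c]
        using H' h' by (intro eq_vecI) auto
    qed
    ultimately show ?thesis
      unfolding Gamma_def Phi_def gamma_def data[symmetric]
      using D H' B C A Ti t(1) c d h' u z by (subst append_rows_affine[of _ r m _ s _ k]) auto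
  qed
  have solvable: "\<exists>u \<in> carrier_vec m.
      Gamma P H i *\<^sub>v u + Phi P H T i *\<^sub>v z + gamma P H h t i = 0\<^sub>v (r + s)"
    if z: "z \<in> carrier_vec k" for z
  proof -
    define x where "x = T i *\<^sub>v z + t i"
    have Tz: "T i *\<^sub>v z \<in> carrier_vec n" using Ti z by simp
    \<comment> \<open>Adding a kernel element to \<open>t i\<close> preserves the equation of
      \<open>H i\<close>, so \<open>x\<close> lies in the suffix domain.\<close>
    have "T i *\<^sub>v z \<in> mat_kernel (H i)"
      using mat_kernel_eq_range[OF Hi assms(6)[OF i(1)]] z unfolding dims by blast
    then have "H i *\<^sub>v x + h i = 0\<^sub>v (dim_vec (h i))"
      unfolding x_def mult_add_distrib_mat_vec[OF Hi Tz t(1)]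
      using mat_kernelD(2)[OF Hi] t Hi by simp
    then have "x \<in> suffix_domain P i"
      using assms(4)[OF i(1)] Tz t(1) unfolding x_def dims by auto
    then obtain u x' where u: "u \<in> carrier_vec m" and st: "stage_ok P i x u x'"
      and x': "x' \<in> suffix_domain P (Suc i)"
      using suffix_domain_successor[OF _ assms(7)] unfolding dims by metis
    have "H' *\<^sub>v x' + h' = 0\<^sub>v s"
      using x' assms(4)[OF i(2)] unfolding dims data by auto
    \<comment> \<open>The dynamics in \<open>st\<close> identify \<open>x'\<close> with
      \<open>A x + B u + c\<close>, so both blocks vanish.\<close>
    then have "Gamma P H i *\<^sub>v u + Phi P H T i *\<^sub>v z + gamma P H h t i = 0\<^sub>v (r + s)"
      using st unfolding system[OF z u x_def] stage_ok_def dims data by (simp add: zero_append_vec)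
    then show ?thesis using u by blast
  qed
  obtain Y y where Y: "Y \<in> carrier_mat m k" and y: "y \<in> carrier_vec m"
    and sol: "\<And>z u. z \<in> carrier_vec k \<Longrightarrow> u \<in> carrier_vec m \<Longrightarrow>
      Gamma P H i *\<^sub>v u + Phi P H T i *\<^sub>v z + gamma P H h t i = 0\<^sub>v (r + s) \<longleftrightarrow>
      u - (Y *\<^sub>v z + y) \<in> mat_kernel (Gamma P H i)"
    using parametric_system_solutions[OF G F g solvable] by blast
  obtain mbar Z where Z: "null_space_basis (Gamma P H i) mbar Z"
    by (rule null_space_basis_exists)
  then have Zc: "Z \<in> carrier_mat m mbar"
    using G unfolding null_space_basis_def by auto
  have "{u \<in> carrier_vec m.
      Gamma P H i *\<^sub>v u + Phi P H T i *\<^sub>v z + gamma P H h t i = 0\<^sub>v (r + s)}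
      = {Y *\<^sub>v z + Z *\<^sub>v v + y | v. v \<in> carrier_vec mbar}"
    if z: "z \<in> carrier_vec k" for z
  proof -
    \<comment> \<open>With \<open>w = Z v\<close>, this turns kernel membership of the deviation
      into the required form of \<open>u\<close>.\<close>
    have "u - (Y *\<^sub>v z + y) = w \<longleftrightarrow> u = Y *\<^sub>v z + w + y"
      if "u \<in> carrier_vec m" "w \<in> carrier_vec m" for u w
      using that Y y by (auto simp: vec_eq_iff algebra_simps)
    moreover have "Z *\<^sub>v v \<in> carrier_vec m" "Y *\<^sub>v z + Z *\<^sub>v v + y \<in> carrier_vec m" for v
      using Y Zc y by (auto intro!: carrier_vecI)
    ultimately show ?thesis
      using sol[OF z] unfolding mat_kernel_eq_range[OF G Z] by auto
  qed
  moreover have "dim_row (Gamma P H i) = r + s" using G by simp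
  ultimately show ?thesis
    using solvable Y Zc y Z unfolding m_def k_def by auto
qed

end
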